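(* Let $n,m,z$ be positive integers with $z\le n$, let $A\in\mathbb{R}^{n\times n}$, $B\in\mathbb{R}^{n\times m}$, $C\in\mathbb{R}^{z\times n}$, and let $\alpha>0$ be real with $k-1<\alpha\le k$, $k$ a positive integer. For any finite real $t>0$, the Caputo fractional differential system of order $\alpha$ $$\left({}^{C}D_{0+}^{\alpha}x_\alpha\right)(\tau)=Ax_\alpha(\tau)+Bu(\tau),\qquad y_\alpha(\tau)=Cx_\alpha(\tau),$$ is observable in $[0,t]$ only if the standard system (the case $\alpha=1$) $$\dot x(\tau)=Ax(\tau)+Bu(\tau),\qquad y(\tau)=Cx(\tau)$$ is observable.
   Context: The system is given initial conditions $x_\alpha^{(j)}(0)=x_{0j}\in\mathbb{R}^n$, $j=0,1,\dots,k-1$. Admissible controls $u:[0,\infty)\to\mathbb{R}^m$ are bounded piecewise continuous functions. For each such $u$ and each set of initial conditions, the unique solution of the Caputo system on $[0,\infty)$ is $$x_\alpha(t)=\sum_{j=0}^{k-1}t^{j}\Phi_{\alpha j}(t)x_{0j}+\int_0^t(t-\tau)^{\alpha-1}\Phi_\alpha(t-\tau)Bu(\tau)\,d\tau,$$ $$\Phi_{\alpha j}(t)=\sum_{\ell=0}^{\infty}\frac{A^\ell t^{\alpha\ell}}{\Gamma(\alpha\ell+j+1)},\qquad \Phi_\alpha(t)=\sum_{\ell=0}^{\infty}\frac{A^\ell t^{\alpha\ell}}{\Gamma(\alpha(\ell+1))},$$ where $\Gamma$ is the Gamma function. The system of order $\alpha$ is observable in the observation interval $[0,t]$, $t>0$,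 if the initial conditions $x_{00},\dots,x_{0,k-1}$ can be uniquely determined from the output $y_\alpha(\tau)$, $\tau\in[0,t]$, the control $u$ being known; that is, for a given admissible $u$, two sets of initial conditions producing the same output on $[0,t]$ coincide. The standard system is observable if $x(0)$ is uniquely determined, in the same sense, by the output and the known control on $[0,T]$ for every $T>0$. *)

theory Defs
  imports "HOL-Analysis.Analysis"
begin

text \<open>
  Signals live on the half-line \<open>[0,\<infinity>)\<close>: functions are total on the reals, but their values at
  negative times are never used. In particular derivatives are taken within \<open>{0..}\<close>, so that
  they are two-sided at positive times and right-sided at \<open>0\<close>.
\<close>

primrec nderiv :: "nat \<Rightarrow> (real \<Rightarrow> 'a::real_normed_vector) \<Rightarrow> real \<Rightarrow> 'a" where
  "nderiv 0 f = f"
| "nderiv (Suc j) f = (\<lambda>t. vector_derivative (nderiv j f) (at t within {0..}))"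

definition C_halfline :: "nat \<Rightarrow> (real \<Rightarrow> 'a::real_normed_vector) \<Rightarrow> bool" where
  "C_halfline j f \<longleftrightarrow>
     (\<forall>i<j. \<forall>t\<ge>0. nderiv i f differentiable (at t within {0..})) \<and>
     continuous_on {0..} (nderiv j f)"

text \<open>
  Riemann--Liouville fractional integral \<open>I\<^sub>0\<^sub>+\<close> of order \<open>\<beta> \<ge> 0\<close>; order \<open>0\<close> is the identity.
\<close>

definition RL_integral :: "real \<Rightarrow> (real \<Rightarrow> 'a::euclidean_space) \<Rightarrow> real \<Rightarrow> 'a" where
  "RL_integral \<beta> f t =
     (if \<beta> = 0 then f t
      else (1 / Gamma \<beta>) *\<^sub>R integral {0..t} (\<lambda>s. (t - s) powr (\<beta> - 1) *\<^sub>R f s))"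

text \<open>
  Caputo derivative of order \<open>\<alpha>\<close>, \<open>k - 1 < \<alpha> \<le> k\<close>: the Riemann--Liouville derivative
  \<open>(d/dt)^k I^(k-\<alpha>)\<close> of \<open>x\<close> minus its Taylor polynomial of degree \<open>k - 1\<close> at \<open>0\<close> (the definition
  of Kilbas, Srivastava and Trujillo). It agrees with \<open>I^(k-\<alpha>) x^(k)\<close> for \<open>k\<close> times continuously
  differentiable \<open>x\<close>, but the latter need not make sense on the solutions of the
  system below, since those need not be \<open>k\<close> times differentiable when the control is merely
  piecewise continuous. For \<open>\<alpha> = k\<close> it is the ordinary \<open>k\<close>-th derivative.
\<close>

definition caputo_remainder_integral ::
    "real \<Rightarrow> nat \<Rightarrow> (real \<Rightarrow> 'a::euclidean_space) \<Rightarrow> real \<Rightarrow> 'a" where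
  "caputo_remainder_integral \<alpha> k x =
     RL_integral (real k - \<alpha>) (\<lambda>s. x s - (\<Sum>j<k. (s ^ j / fact j) *\<^sub>R nderiv j x 0))"

definition has_caputo_derivative ::
    "real \<Rightarrow> nat \<Rightarrow> (real \<Rightarrow> 'a::euclidean_space) \<Rightarrow> 'a \<Rightarrow> real \<Rightarrow> bool" where
  "has_caputo_derivative \<alpha> k x D \<tau> \<longleftrightarrow>
     (\<forall>i<k - 1. \<forall>\<^sub>F s in nhds \<tau>.
        nderiv i (caputo_remainder_integral \<alpha> k x) differentiable (at s within {0..})) \<and>
     (nderiv (k - 1) (caputo_remainder_integral \<alpha> k x) has_vector_derivative D)
       (at \<tau> within {0..})"

text \<open>
  Bounded piecewise continuous controls: finitely many discontinuities in every bounded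
  interval, and one-sided limits everywhere.
\<close>

definition admissible_control :: "(real \<Rightarrow> 'a::real_normed_vector) \<Rightarrow> bool" where
  "admissible_control u \<longleftrightarrow>
     bounded (u ` {0..}) \<and>
     (\<forall>T. finite {\<tau>\<in>{0..T}. \<not> continuous (at \<tau> within {0..}) u}) \<and>
     (\<forall>\<tau>>0. \<exists>l. (u \<longlongrightarrow> l) (at_left \<tau>)) \<and>
     (\<forall>\<tau>\<ge>0. \<exists>l. (u \<longlongrightarrow> l) (at_right \<tau>))"

text \<open>
  At a jump of the control the left-hand side of the differential equation does not exist
  in general, so the equation is required at the positive times where the control is
  continuous. Together with \<open>x \<in> C^(k-1)[0,\<infinity>)\<close> this makes the
  Cauchy problem uniquely solvable, the solution being
  \<open>x(t) = (\<Sum>j<k. t^j \<Phi>\<^sub>\<alpha>\<^sub>j(t) x\<^sub>0\<^sub>j) + \<integral>\<^sub>0\<^sup>t (t-\<tau>)^(\<alpha>-1) \<Phi>\<^sub>\<alpha>(t-\<tau>) B u(\<tau>) d\<tau>\<close> with the usual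
  Mittag-Leffler matrix functions \<open>\<Phi>\<^sub>\<alpha>\<^sub>j\<close>, \<open>\<Phi>\<^sub>\<alpha>\<close>. Only \<open>x0 j\<close> with \<open>j < k\<close> matters.
\<close>

definition caputo_solution ::
    "real^'n^'n \<Rightarrow> real^'m^'n \<Rightarrow> real \<Rightarrow> nat \<Rightarrow> (nat \<Rightarrow> real^'n) \<Rightarrow> (real \<Rightarrow> real^'m)
      \<Rightarrow> (real \<Rightarrow> real^'n) \<Rightarrow> bool" where
  "caputo_solution A B \<alpha> k x0 u x \<longleftrightarrow>
     C_halfline (k - 1) x \<and>
     (\<forall>j<k. nderiv j x 0 = x0 j) \<and>
     (\<forall>\<tau>>0. continuous (at \<tau>) u \<longrightarrow> has_caputo_derivative \<alpha> k x (A *v x \<tau> + B *v u \<tau>) \<tau>)"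

definition caputo_observable ::
    "real^'n^'n \<Rightarrow> real^'m^'n \<Rightarrow> real^'n^'z \<Rightarrow> real \<Rightarrow> nat \<Rightarrow> real \<Rightarrow> bool" where
  "caputo_observable A B C \<alpha> k t \<longleftrightarrow>
     (\<forall>u x0 x0' x x'.
        admissible_control u \<longrightarrow>
        caputo_solution A B \<alpha> k x0 u x \<longrightarrow> caputo_solution A B \<alpha> k x0' u x' \<longrightarrow>
        (\<forall>\<tau>\<in>{0..t}. C *v x \<tau> = C *v x' \<tau>) \<longrightarrow>
        (\<forall>j<k. x0 j = x0' j))"

definition standard_solution ::
    "real^'n^'n \<Rightarrow> real^'m^'n \<Rightarrow> real^'n \<Rightarrow> (real \<Rightarrow> real^'m) \<Rightarrow> (real \<Rightarrow> real^'n) \<Rightarrow> bool" where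
  "standard_solution A B x0 u x \<longleftrightarrow>
     continuous_on {0..} x \<and>
     x 0 = x0 \<and>
     (\<forall>\<tau>>0. continuous (at \<tau>) u \<longrightarrow> (x has_vector_derivative (A *v x \<tau> + B *v u \<tau>)) (at \<tau>))"

definition standard_observable ::
    "real^'n^'n \<Rightarrow> real^'m^'n \<Rightarrow> real^'n^'z \<Rightarrow> bool" where
  "standard_observable A B C \<longleftrightarrow>
     (\<forall>T>0. \<forall>u x0 x0' x x'.
        admissible_control u \<longrightarrow>
        standard_solution A B x0 u x \<longrightarrow> standard_solution A B x0' u x' \<longrightarrow>
        (\<forall>\<tau>\<in>{0..T}. C *v x \<tau> = C *v x' \<tau>) \<longrightarrow>
        x0 = x0')"

text \<open>The standard system is the Caputo system of order \<open>1\<close>.\<close>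

lemma caputo_solution_order_one:
  "caputo_solution A B 1 1 x0 u x \<longleftrightarrow> standard_solution A B (x0 0) u x"
proof -
  have J: "caputo_remainder_integral 1 (Suc 0) x = (\<lambda>s. x s - x 0)"
    by (simp add: caputo_remainder_integral_def RL_integral_def fun_eq_iff)
  have "(((\<lambda>s. x s - x 0) has_vector_derivative D) (at \<tau> within {0..})) \<longleftrightarrow>
        (x has_vector_derivative D) (at \<tau>)" if "\<tau> > 0" for D \<tau>
  proof -
    have "at \<tau> within {0..} = at \<tau>"
      using that by (intro at_within_interior) (simp add: interior_real_atLeast)
    moreover have "(x has_vector_derivative D) (at \<tau>)"
      if "((\<lambda>s. x s - x 0) has_vector_derivative D) (at \<tau>)"
      using has_vector_derivative_add[OF that has_vector_derivative_const[of "x 0"]] by simp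
    moreover have "((\<lambda>s. x s - x 0) has_vector_derivative D) (at \<tau>)"
      if "(x has_vector_derivative D) (at \<tau>)"
      using has_vector_derivative_diff[OF that has_vector_derivative_const[of "x 0"]] by simp
    ultimately show ?thesis by auto
  qed
  then show ?thesis
    by (simp add: caputo_solution_def standard_solution_def C_halfline_def
        has_caputo_derivative_def J)
qed

end

theory Submission
  imports Defs
begin

text \<open>
  If the standard system is not observable, the difference of two indistinguishable solutions
  solves \<open>d' = A d\<close> near \<open>0\<close> with \<open>C d = 0\<close>, and differentiating repeatedly gives a vector
  \<open>v \<noteq> 0\<close> with \<open>C A\<^sup>l v = 0\<close> for all \<open>l\<close>. The Caputo system with control \<open>0\<close> and only nonzero
  initial value \<open>x\<^sub>0\<^sub>,\<^sub>k\<^sub>-\<^sub>1 = v\<close> has the solution \<open>\<Sum>l. t\<^sup>\<alpha>\<^sup>l\<^sup>+\<^sup>k\<^sup>-\<^sup>1 / \<Gamma>(\<alpha>l + k) A\<^sup>l v\<close>, whose output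
  vanishes, so it cannot be told apart from the zero solution. That this series is a
  solution follows from the semigroup law of fractional integration applied termwise.
\<close>

section \<open>Power kernels of fractional integration\<close>

text \<open>The case \<open>a = 0\<close> is separate because \<open>0 powr 0 = 0\<close>.\<close>

definition RL_kernel :: "real \<Rightarrow> real \<Rightarrow> real" where
  "RL_kernel a s = (if a = 0 then 1 else s powr a / Gamma (a + 1))"

lemma RL_kernel_0 [simp]: "RL_kernel 0 s = 1"
  by (simp add: RL_kernel_def)

lemma RL_kernel_at_0: "RL_kernel a 0 = (if a = 0 then 1 else 0)"
  by (simp add: RL_kernel_def)

lemma RL_kernel_pos: "s > 0 \<Longrightarrow> RL_kernel a s = s powr a / Gamma (a + 1)"
  by (simp add: RL_kernel_def)

lemma RL_kernel_of_nat: "s \<ge> 0 \<Longrightarrow> RL_kernel (real j) s = s ^ j / fact j"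
  using Gamma_fact[of j, where ?'a = real]
  by (cases "s = 0") (auto simp: RL_kernel_def powr_realpow add.commute)

lemma RL_kernel_nonneg: "a \<ge> 0 \<Longrightarrow> RL_kernel a s \<ge> 0"
  by (simp add: RL_kernel_def less_imp_le Gamma_real_pos)

lemma Gamma_real_nonzero: "(x::real) > 0 \<Longrightarrow> Gamma x \<noteq> 0"
  using Gamma_real_pos[of x] by linarith

lemma continuous_on_RL_kernel:
  assumes "a \<ge> 0"
  shows "continuous_on {0..} (RL_kernel a)"
proof (cases "a = 0")
  case False
  then have "continuous_on {0..} (\<lambda>s. s powr a / Gamma (a + 1))"
    using assms Gamma_real_nonzero[of "a + 1"]
    by (intro continuous_on_divide continuous_on_powr' continuous_on_id continuous_on_const) auto
  with False show ?thesis
    by (simp add: RL_kernel_def [abs_def])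
qed (simp add: RL_kernel_def [abs_def])

text \<open>Restricting Euler's integral to \<open>{R..R+1}\<close> gives growth of \<open>\<Gamma>\<close> along any real progression.\<close>

lemma powr_le_exp_mult_Gamma:
  fixes R y :: real
  assumes "R > 0" "y \<ge> 0"
  shows "R powr y \<le> exp (R + 1) * Gamma (y + 1)"
proof -
  have G: "((\<lambda>s. s powr y / exp s) has_integral Gamma (y + 1)) {0..}"
    using Gamma_integral_real[of "y + 1"] assms by simp
  have "((\<lambda>s. R powr y / exp (R + 1)) has_integral R powr y / exp (R + 1)) {R..R + 1}"
    using has_integral_const_real[of "R powr y / exp (R + 1)" R "R + 1"] by simp
  moreover have "(\<lambda>s. s powr y / exp s) integrable_on {R..R + 1}"
    using assms by (intro integrable_continuous_real continuous_intros) auto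
  ultimately have "R powr y / exp (R + 1) \<le> integral {R..R + 1} (\<lambda>s. s powr y / exp s)"
    using assms by (intro has_integral_le[OF _ integrable_integral]) (auto intro!: frac_le powr_mono2)
  also have "\<dots> \<le> Gamma (y + 1)"
    using \<open>(\<lambda>s. s powr y / exp s) integrable_on {R..R + 1}\<close> assms
    by (intro has_integral_subset_le[OF _ integrable_integral G]) auto
  finally show ?thesis
    by (simp add: field_simps)
qed

text \<open>The parameter \<open>R\<close> is free: \<open>Gamma (a + 1)\<close> dominates any
  \<open>R powr a\<close> up to a constant, so a choice of \<open>R\<close> above \<open>T\<close>
  makes the bound decay geometrically in \<open>a\<close>.\<close>

lemma RL_kernel_bound:
  assumes "R > 0" "T > 0" "a \<ge> 0" "0 \<le> s" "s \<le> T"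
  shows "RL_kernel a s \<le> exp (R + 1) * (T / R) powr a"
proof (cases "a = 0")
  case True
  with assms show ?thesis by simp
next
  case False
  have "RL_kernel a s = s powr a / Gamma (a + 1)"
    using False by (simp add: RL_kernel_def)
  also have "\<dots> \<le> T powr a / Gamma (a + 1)"
    using assms by (intro divide_right_mono powr_mono2) (auto simp: less_imp_le Gamma_real_pos)
  also have "\<dots> \<le> T powr a * (exp (R + 1) / R powr a)"
    using powr_le_exp_mult_Gamma[of R a] assms Gamma_real_pos[of "a + 1"]
    by (auto simp: field_simps)
  also have "\<dots> = exp (R + 1) * (T / R) powr a"
    using assms by (simp add: powr_divide)
  finally show ?thesis .
qed

text \<open>Euler's Beta integral, rescaled from \<open>{0..1}\<close> to \<open>{0..t}\<close>.
  After division by \<open>Gamma \<gamma>\<close> it is the semigroup law: the fractional integral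
  of order \<gamma> raises the kernel index by \<gamma>.\<close>

lemma has_integral_RL_kernel:
  assumes "a \<ge> 0" "\<gamma> > 0" "t \<ge> 0"
  shows "((\<lambda>s. (t - s) powr (\<gamma> - 1) * RL_kernel a s) has_integral
            Gamma \<gamma> * RL_kernel (a + \<gamma>) t) {0..t}"
proof (cases "t = 0")
  case True
  with assms has_integral_refl(2)[of _ "0 :: real"] show ?thesis
    by (simp add: RL_kernel_at_0)
next
  case False
  with assms have t: "t > 0" by simp
  have "((\<lambda>s. s powr a * (1 - s) powr (\<gamma> - 1)) has_integral Beta (a + 1) \<gamma>) {0..1}"
    using has_integral_Beta_real[of "a + 1" \<gamma>] assms by simp
  from has_integral_stretch_real[OF this, of "1 / t"] t
  have "((\<lambda>s. (s / t) powr a * (1 - s / t) powr (\<gamma> - 1)) has_integral t * Beta (a + 1) \<gamma>) {0..t}"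
    by (simp add: image_mult_atLeastAtMost_if')
  from has_integral_mult_right[OF this, of "t powr (a + \<gamma> - 1) / Gamma (a + 1)"]
  have "((\<lambda>s. t powr (a + \<gamma> - 1) / Gamma (a + 1) * ((s / t) powr a * (1 - s / t) powr (\<gamma> - 1)))
          has_integral t powr (a + \<gamma> - 1) / Gamma (a + 1) * (t * Beta (a + 1) \<gamma>)) {0..t}" .
  also have "t powr (a + \<gamma> - 1) / Gamma (a + 1) * (t * Beta (a + 1) \<gamma>)
      = Gamma \<gamma> * RL_kernel (a + \<gamma>) t"
    using t assms Gamma_real_nonzero[of "a + 1"]
    by (simp add: RL_kernel_pos Beta_def powr_diff field_simps)
  finally have int: "((\<lambda>s. t powr (a + \<gamma> - 1) / Gamma (a + 1) * ((s / t) powr a * (1 - s / t) powr (\<gamma> - 1)))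
      has_integral Gamma \<gamma> * RL_kernel (a + \<gamma>) t) {0..t}" .
  \<comment> \<open>The point 0 is left out because for \<open>a = 0\<close> the kernel is 1 there
    while \<open>(0 / t) powr 0\<close> is 0.\<close>
  have "(t - s) powr (\<gamma> - 1) * RL_kernel a s
      = t powr (a + \<gamma> - 1) / Gamma (a + 1) * ((s / t) powr a * (1 - s / t) powr (\<gamma> - 1))" if "s \<in> {0..t} - {0}" for s
  proof -
    have "(1 - s / t) powr (\<gamma> - 1) = (t - s) powr (\<gamma> - 1) / t powr (\<gamma> - 1)"
      using that t by (subst powr_divide [symmetric]) (auto simp: diff_divide_distrib)
    moreover have "t powr (a + \<gamma> - 1) = t powr a * t powr (\<gamma> - 1)"
      by (simp flip: powr_add add: algebra_simps)
    ultimately show ?thesis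
      using that t by (simp add: RL_kernel_pos powr_divide)
  qed
  then show ?thesis
    by (rule has_integral_spike_finite[OF finite.insertI[OF finite.emptyI] _ int])
qed

section \<open>Mittag-Leffler series: convergence and continuity\<close>

text \<open>This is \<open>s^b E_{\<alpha>,b+1}(s^\<alpha> A) w\<close> with the two-parameter
  Mittag-Leffler function \<open>E\<close>; for \<open>b = j\<close> it is the term
  \<open>t^j \<Phi>\<^sub>\<alpha>\<^sub>j(t) w\<close> of the solution formula. With
  \<open>b\<close> general, integration and differentiation become shifts of
  \<open>b\<close>.\<close>

definition mittag_leffler ::
    "real^'n^'n \<Rightarrow> real \<Rightarrow> real \<Rightarrow> real^'n \<Rightarrow> real \<Rightarrow> real^'n" where
  "mittag_leffler A \<alpha> b w s = (\<Sum>l. RL_kernel (\<alpha> * real l + b) s *\<^sub>R ((*v) A ^^ l) w)"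

text \<open>The vectors \<open>A^l w\<close> grow at most geometrically, while the kernels decay
  faster than any geometric sequence. The majorant is independent of \<open>s\<close>, so it serves
  the Weierstrass test and dominated convergence alike.\<close>

lemma mittag_leffler_majorant:
  fixes A :: "real^'n^'n"
  assumes "\<alpha> > 0" "b \<ge> 0"
  obtains M where "summable M"
    "\<And>l s. 0 \<le> s \<Longrightarrow> s \<le> T \<Longrightarrow> norm (RL_kernel (\<alpha> * real l + b) s *\<^sub>R ((*v) A ^^ l) w) \<le> M l"
proof -
  define T' where "T' = max T 1"
  have T': "T' > 0" "T \<le> T'" by (auto simp: T'_def)
  obtain K where K: "K > 0" "\<And>x. norm (A *v x) \<le> norm x * K"
    using bounded_linear.pos_bounded[OF matrix_vector_mul_bounded_linear[of A]] by blast
  \<comment> \<open>Chosen so that \<open>(T' / R) powr \<alpha> = 1 / (2 * K)\<close>: each further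
    term costs a factor \<open>K\<close> from \<open>A\<close> and gains \<open>1 / (2 * K)\<close>
    from the kernel, which leaves the ratio \<open>1 / 2\<close>.\<close>
  define R where "R = T' * (2 * K) powr (1 / \<alpha>)"
  have R: "R > 0" using T' K by (simp add: R_def)
  have q: "(T' / R) powr \<alpha> = 1 / (2 * K)"
    using T' K assms by (simp add: R_def powr_divide powr_powr)
  have pow: "norm (((*v) A ^^ l) w) \<le> K ^ l * norm w" for l
  proof (induction l)
    case (Suc l)
    have "norm (((*v) A ^^ Suc l) w) \<le> norm (((*v) A ^^ l) w) * K"
      using K by simp
    also have "\<dots> \<le> K ^ l * norm w * K"
      using Suc K by (intro mult_right_mono) auto
    finally show ?case by (simp add: mult_ac)
  qed simp
  define c where "c = exp (R + 1) * (T' / R) powr b * norm w"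
  show thesis
  proof (rule that)
    show "summable (\<lambda>l. c * (1 / 2) ^ l)"
      by (intro summable_mult summable_geometric) simp
  next
    fix l :: nat and s :: real
    assume s: "0 \<le> s" "s \<le> T"
    have a: "\<alpha> * real l + b \<ge> 0" using assms by simp
    have "norm (RL_kernel (\<alpha> * real l + b) s *\<^sub>R ((*v) A ^^ l) w)
        \<le> (exp (R + 1) * (T' / R) powr (\<alpha> * real l + b)) * (K ^ l * norm w)"
      using RL_kernel_nonneg[OF a] RL_kernel_bound[OF R T'(1) a s(1)] s T' pow
      by (auto intro!: mult_mono)
    also have "(T' / R) powr (\<alpha> * real l + b) = (1 / (2 * K)) ^ l * (T' / R) powr b"
      using T' R K by (simp add: powr_add q powr_realpow flip: powr_powr)
    also have "exp (R + 1) * ((1 / (2 * K)) ^ l * (T' / R) powr b) * (K ^ l * norm w)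
        = c * (1 / 2) ^ l"
      using K by (simp add: c_def field_simps)
    finally show "norm (RL_kernel (\<alpha> * real l + b) s *\<^sub>R ((*v) A ^^ l) w) \<le> c * (1 / 2) ^ l" .
  qed
qed

lemma summable_mittag_leffler:
  fixes A :: "real^'n^'n"
  assumes "\<alpha> > 0" "b \<ge> 0" "s \<ge> 0"
  shows "summable (\<lambda>l. RL_kernel (\<alpha> * real l + b) s *\<^sub>R ((*v) A ^^ l) w)"
proof -
  obtain M where M: "summable M"
    "\<And>l r. 0 \<le> r \<Longrightarrow> r \<le> s \<Longrightarrow> norm (RL_kernel (\<alpha> * real l + b) r *\<^sub>R ((*v) A ^^ l) w) \<le> M l"
    using mittag_leffler_majorant[OF assms(1,2)] by metis
  show ?thesis
    by (rule summable_comparison_test'[OF M(1), of 0]) (use M(2) assms(3) in simp)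
qed

lemma continuous_on_mittag_leffler:
  assumes "\<alpha> > 0" "b \<ge> 0"
  shows "continuous_on {0..} (mittag_leffler A \<alpha> b w)"
proof -
  have cont: "continuous_on {0..T} (mittag_leffler A \<alpha> b w)" for T
  proof -
    obtain M where M: "summable M"
      "\<And>l r. 0 \<le> r \<Longrightarrow> r \<le> T \<Longrightarrow> norm (RL_kernel (\<alpha> * real l + b) r *\<^sub>R ((*v) A ^^ l) w) \<le> M l"
      using mittag_leffler_majorant[OF assms] by metis
    have "uniform_limit {0..T} (\<lambda>n r. \<Sum>l<n. RL_kernel (\<alpha> * real l + b) r *\<^sub>R ((*v) A ^^ l) w)
        (mittag_leffler A \<alpha> b w) sequentially"
      unfolding mittag_leffler_def [abs_def] by (rule Weierstrass_m_test[OF _ M(1)]) (use M in auto)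
    moreover have "continuous_on {0..T} (\<lambda>r. \<Sum>l<n. RL_kernel (\<alpha> * real l + b) r *\<^sub>R ((*v) A ^^ l) w)" for n
      using assms
      by (intro continuous_intros continuous_on_subset[OF continuous_on_RL_kernel]) auto
    ultimately show ?thesis
      by (intro uniform_limit_theorem[of _ _ sequentially]) auto
  qed
  \<comment> \<open>Continuity is local, so at each \<open>s\<close> the compact interval
    \<open>{0..s + 1}\<close> can replace the half-line.\<close>
  show ?thesis
    unfolding continuous_on_eq_continuous_within
  proof
    fix s :: real
    assume "s \<in> {0..}"
    then have "continuous (at s within {0..s + 1}) (mittag_leffler A \<alpha> b w)"
      using cont[of "s + 1"] by (auto simp: continuous_on_eq_continuous_within)
    moreover have "at s within {0..s + 1} = at s within {0..}"
      by (rule at_within_nhd[of _ "{..<s + 1}"]) auto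
    ultimately show "continuous (at s within {0..}) (mittag_leffler A \<alpha> b w)"
      by simp
  qed
qed

section \<open>Integration and differentiation of the series\<close>

text \<open>The semigroup law holds for each kernel; dominated convergence carries it from partial
  sums to the series.\<close>

lemma has_integral_mittag_leffler:
  assumes "\<alpha> > 0" "b \<ge> 0" "\<gamma> > 0" "t \<ge> 0"
  shows "((\<lambda>s. (t - s) powr (\<gamma> - 1) *\<^sub>R mittag_leffler A \<alpha> b w s) has_integral
            Gamma \<gamma> *\<^sub>R mittag_leffler A \<alpha> (b + \<gamma>) w t) {0..t}"
proof -
  obtain M where M: "summable M"
    "\<And>l r. 0 \<le> r \<Longrightarrow> r \<le> t \<Longrightarrow> norm (RL_kernel (\<alpha> * real l + b) r *\<^sub>R ((*v) A ^^ l) w) \<le> M l"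
    using mittag_leffler_majorant[OF assms(1,2)] by metis
  let ?S = "\<lambda>b n s. \<Sum>l<n. RL_kernel (\<alpha> * real l + b) s *\<^sub>R ((*v) A ^^ l) w"
  have lim: "(\<lambda>n. ?S c n s) \<longlonglongrightarrow> mittag_leffler A \<alpha> c w s" if "c \<ge> 0" "s \<ge> 0" for c s
    unfolding mittag_leffler_def using summable_mittag_leffler[OF assms(1) that] by (rule summable_LIMSEQ)
  show ?thesis
  proof (rule has_integral_dominated_convergence)
    show "((\<lambda>s. (t - s) powr (\<gamma> - 1) *\<^sub>R ?S b n s) has_integral Gamma \<gamma> *\<^sub>R ?S (b + \<gamma>) n t) {0..t}" for n
    proof -
      have "((\<lambda>s. \<Sum>l<n. ((t - s) powr (\<gamma> - 1) * RL_kernel (\<alpha> * real l + b) s) *\<^sub>R ((*v) A ^^ l) w)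
          has_integral (\<Sum>l<n. (Gamma \<gamma> * RL_kernel (\<alpha> * real l + b + \<gamma>) t) *\<^sub>R ((*v) A ^^ l) w)) {0..t}"
        using assms by (intro has_integral_sum has_integral_scaleR_left has_integral_RL_kernel) auto
      then show ?thesis
        by (simp add: scaleR_sum_right add.assoc)
    qed
    \<comment> \<open>The weight may be singular at \<open>t\<close> when
      \<open>\<gamma> < 1\<close>; its integrability is the semigroup law for
      \<open>a = 0\<close>.\<close>
    show "(\<lambda>s. (t - s) powr (\<gamma> - 1) * suminf M) integrable_on {0..t}"
      using has_integral_RL_kernel[of 0 \<gamma> t] assms
      by (intro integrable_on_mult_left) (auto simp: integrable_on_def)
    show "\<forall>s\<in>{0..t}. norm ((t - s) powr (\<gamma> - 1) *\<^sub>R ?S b n s) \<le> (t - s) powr (\<gamma> - 1) * suminf M" for n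
    proof
      fix s assume s: "s \<in> {0..t}"
      have M_nonneg: "0 \<le> M l" for l
        using order_trans[OF norm_ge_zero M(2)[of s l]] s by simp
      have "norm (?S b n s) \<le> (\<Sum>l<n. M l)"
        using M(2) s by (intro sum_norm_le) auto
      also have "\<dots> \<le> suminf M"
        using M(1) M_nonneg by (intro sum_le_suminf) auto
      finally show "norm ((t - s) powr (\<gamma> - 1) *\<^sub>R ?S b n s) \<le> (t - s) powr (\<gamma> - 1) * suminf M"
        by (simp add: mult_left_mono)
    qed
    show "\<forall>s\<in>{0..t}. (\<lambda>n. (t - s) powr (\<gamma> - 1) *\<^sub>R ?S b n s)
        \<longlonglongrightarrow> (t - s) powr (\<gamma> - 1) *\<^sub>R mittag_leffler A \<alpha> b w s"
      using assms by (auto intro!: tendsto_scaleR lim)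
    show "(\<lambda>n. Gamma \<gamma> *\<^sub>R ?S (b + \<gamma>) n t) \<longlonglongrightarrow> Gamma \<gamma> *\<^sub>R mittag_leffler A \<alpha> (b + \<gamma>) w t"
      using assms by (intro tendsto_scaleR tendsto_const lim) auto
  qed
qed

lemma RL_integral_mittag_leffler:
  assumes "\<alpha> > 0" "b \<ge> 0" "\<gamma> \<ge> 0" "t \<ge> 0"
  shows "RL_integral \<gamma> (mittag_leffler A \<alpha> b w) t = mittag_leffler A \<alpha> (b + \<gamma>) w t"
proof (cases "\<gamma> = 0")
  case False
  then have "\<gamma> > 0" using assms by simp
  with integral_unique[OF has_integral_mittag_leffler[OF assms(1,2) this assms(4), of A w]]
    Gamma_real_nonzero[of \<gamma>] \<open>\<gamma> > 0\<close>
  show ?thesis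
    by (simp add: RL_integral_def)
qed (simp add: RL_integral_def)

lemma RL_integral_cong:
  assumes "t \<ge> 0" "\<And>s. 0 \<le> s \<Longrightarrow> s \<le> t \<Longrightarrow> f s = g s"
  shows "RL_integral \<gamma> f t = RL_integral \<gamma> g t"
proof (cases "\<gamma> = 0")
  case False
  have "integral {0..t} (\<lambda>s. (t - s) powr (\<gamma> - 1) *\<^sub>R f s)
      = integral {0..t} (\<lambda>s. (t - s) powr (\<gamma> - 1) *\<^sub>R g s)"
    using assms(2) by (intro integral_cong) simp
  with False show ?thesis
    by (simp add: RL_integral_def)
qed (simp add: RL_integral_def assms)

text \<open>Fractional integration of order 1 is the ordinary integral, so the fundamental theorem
  of calculus applies to the continuous series of index \<open>b\<close>.\<close>

lemma mittag_leffler_has_vector_derivative: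
  assumes "\<alpha> > 0" "b \<ge> 0" "s \<ge> 0"
  shows "(mittag_leffler A \<alpha> (b + 1) w has_vector_derivative mittag_leffler A \<alpha> b w s) (at s within {0..})"
proof -
  have int: "integral {0..r} (mittag_leffler A \<alpha> b w) = mittag_leffler A \<alpha> (b + 1) w r"
    if "r \<ge> 0" for r
  proof -
    \<comment> \<open>The weight \<open>(r - s) powr 0\<close> is 1 except at \<open>s = r\<close>,
      where it is 0; hence the exceptional point.\<close>
    have "(mittag_leffler A \<alpha> b w has_integral Gamma 1 *\<^sub>R mittag_leffler A \<alpha> (b + 1) w r) {0..r}"
      using has_integral_mittag_leffler[OF assms(1,2) zero_less_one that]
      by (rule has_integral_spike_finite[of "{r}", rotated 2]) auto
    then show ?thesis by (simp add: integral_unique)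
  qed
  have "((\<lambda>r. integral {0..r} (mittag_leffler A \<alpha> b w)) has_vector_derivative mittag_leffler A \<alpha> b w s)
      (at s within {0..s + 1})"
    using assms
    by (intro integral_has_vector_derivative continuous_on_subset[OF continuous_on_mittag_leffler]) auto
  also have "at s within {0..s + 1} = at s within {0..}"
    by (rule at_within_nhd[of _ "{..<s + 1}"]) auto
  finally have "((\<lambda>r. integral {0..r} (mittag_leffler A \<alpha> b w)) has_vector_derivative
      mittag_leffler A \<alpha> b w s) (at s within {0..})" .
  then show ?thesis
    using assms(3) by (intro has_vector_derivative_transform[OF _ int[symmetric]]) auto
qed

lemma mittag_leffler_at_0:
  assumes "\<alpha> > 0" "b \<ge> 0"
  shows "mittag_leffler A \<alpha> b w 0 = (if b = 0 then w else 0)"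
proof -
  have "(\<lambda>l. RL_kernel (\<alpha> * real l + b) 0 *\<^sub>R ((*v) A ^^ l) w)
      = (\<lambda>l. if l = 0 then (if b = 0 then w else 0) else 0)"
  proof
    fix l :: nat
    show "RL_kernel (\<alpha> * real l + b) 0 *\<^sub>R ((*v) A ^^ l) w
        = (if l = 0 then (if b = 0 then w else 0) else 0)"
    proof (cases "l = 0")
      case False
      then have "\<alpha> * real l + b > 0" using assms by (simp add: add_pos_nonneg)
      with False show ?thesis by (simp add: RL_kernel_at_0)
    qed (simp add: RL_kernel_at_0)
  qed
  then show ?thesis
    using sums_unique[OF sums_single[of 0 "\<lambda>_. if b = 0 then w else 0"]]
    by (simp add: mittag_leffler_def)
qed

lemma funpow_mult_vec_shift: "((*v) A ^^ l) (A *v w) = A *v ((*v) A ^^ l) w"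
  by (simp add: funpow_swap1)

text \<open>The term \<open>l = 0\<close> is peeled off and one \<open>A\<close> of each other term
  moves onto \<open>w\<close>. For \<open>b = k - 1\<close> the peeled term is the Taylor polynomial
  that the Caputo derivative subtracts.\<close>

lemma mittag_leffler_split:
  assumes "\<alpha> > 0" "b \<ge> 0" "s \<ge> 0"
  shows "mittag_leffler A \<alpha> b w s = RL_kernel b s *\<^sub>R w + mittag_leffler A \<alpha> (b + \<alpha>) (A *v w) s"
proof -
  have "RL_kernel (\<alpha> * real (Suc l) + b) s *\<^sub>R ((*v) A ^^ Suc l) w
      = RL_kernel (\<alpha> * real l + (b + \<alpha>)) s *\<^sub>R ((*v) A ^^ l) (A *v w)" for l
    by (simp add: funpow_mult_vec_shift distrib_left add_ac)
  then show ?thesis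
    using suminf_split_head[OF summable_mittag_leffler[OF assms, of A w]]
    unfolding mittag_leffler_def by simp
qed

text \<open>Used to see that the output vanishes as soon as all \<open>C A^l w\<close> do.\<close>

lemma mult_vec_mittag_leffler_series:
  fixes A :: "real^'n^'n" and C :: "real^'n^'z"
  assumes "\<alpha> > 0" "b \<ge> 0" "s \<ge> 0"
  shows "C *v mittag_leffler A \<alpha> b w s = (\<Sum>l. RL_kernel (\<alpha> * real l + b) s *\<^sub>R (C *v ((*v) A ^^ l) w))"
proof -
  have "C *v mittag_leffler A \<alpha> b w s = (\<Sum>l. C *v (RL_kernel (\<alpha> * real l + b) s *\<^sub>R ((*v) A ^^ l) w))"
    unfolding mittag_leffler_def
    by (rule bounded_linear.suminf[OF matrix_vector_mul_bounded_linear summable_mittag_leffler[OF assms]])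
  then show ?thesis
    by (simp only: matrix_vector_mult_scaleR)
qed

lemma mult_vec_mittag_leffler:
  fixes A :: "real^'n^'n"
  assumes "\<alpha> > 0" "b \<ge> 0" "s \<ge> 0"
  shows "A *v mittag_leffler A \<alpha> b w s = mittag_leffler A \<alpha> b (A *v w) s"
  unfolding mult_vec_mittag_leffler_series[OF assms]
  by (simp only: mittag_leffler_def funpow_mult_vec_shift)

section \<open>Iterated derivatives and the Caputo equation\<close>

lemma at_within_half_line_ne_bot: "(s::real) \<ge> 0 \<Longrightarrow> at s within {0..} \<noteq> bot"
  using at_le[of "{s<..}" "{0..}" s] trivial_limit_at_right_real[of s] le_bot by fastforce

text \<open>Iterated derivatives are identified from candidates \<open>F\<close>, by uniqueness of
  derivatives within the half-line. Agreement on \<open>{0..}\<close> suffices, since derivatives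
  are taken within that set.\<close>

lemma nderiv_chain:
  assumes "\<And>s. s \<ge> 0 \<Longrightarrow> f s = F 0 s"
    and "\<And>i s. i < n \<Longrightarrow> s \<ge> 0 \<Longrightarrow> (F i has_vector_derivative F (Suc i) s) (at s within {0..})"
  shows "i \<le> n \<Longrightarrow> s \<ge> 0 \<Longrightarrow> nderiv i f s = F i s"
    and "i < n \<Longrightarrow> s \<ge> 0 \<Longrightarrow> (nderiv i f has_vector_derivative F (Suc i) s) (at s within {0..})"
proof -
  have D: "(nderiv i f has_vector_derivative F (Suc i) s) (at s within {0..})"
    if "i < n" "s \<ge> 0" "\<And>r. r \<ge> 0 \<Longrightarrow> nderiv i f r = F i r" for i s
    by (rule has_vector_derivative_transform[OF _ _ assms(2)[OF that(1,2)]]) (use that in simp_all)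
  have nd: "nderiv i f s = F i s" if "i \<le> n" "s \<ge> 0" for i s
    using that
  proof (induction i arbitrary: s)
    case (Suc i)
    have "(nderiv i f has_vector_derivative F (Suc i) s) (at s within {0..})"
      by (rule D) (use Suc in simp_all)
    from vector_derivative_within[OF at_within_half_line_ne_bot[OF Suc.prems(2)] this]
    show ?case by simp
  qed (simp add: assms(1))
  then show "i \<le> n \<Longrightarrow> s \<ge> 0 \<Longrightarrow> nderiv i f s = F i s" .
  show "i < n \<Longrightarrow> s \<ge> 0 \<Longrightarrow> (nderiv i f has_vector_derivative F (Suc i) s) (at s within {0..})"
    by (rule D) (simp_all add: nd)
qed

lemma mittag_leffler_chain:
  assumes "\<alpha> > 0" "b - real (Suc i) \<ge> 0" "s \<ge> 0"
  shows "(mittag_leffler A \<alpha> (b - real i) w has_vector_derivative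
            mittag_leffler A \<alpha> (b - real (Suc i)) w s) (at s within {0..})"
proof -
  have "b - real i = b - real (Suc i) + 1" by simp
  then show ?thesis
    using mittag_leffler_has_vector_derivative[OF assms] by metis
qed

text \<open>Follow the index: \<open>k - 1\<close> for the solution, \<open>k - 1 + \<alpha>\<close>
  with \<open>A w\<close> in place of \<open>w\<close> after subtracting the Taylor polynomial,
  \<open>2k - 1\<close> after integration of order \<open>k - \<alpha>\<close>, and
  \<open>k - 1\<close> again after \<open>k\<close> derivatives. This last series is
  \<open>A\<close> applied to the solution.\<close>

lemma caputo_solution_mittag_leffler:
  fixes A :: "real^'n^'n" and B :: "real^'m^'n"
  assumes "\<alpha> > 0" "k \<ge> 1" "\<alpha> \<le> real k"
  shows "caputo_solution A B \<alpha> k (\<lambda>j. if j = k - 1 then w else 0) (\<lambda>_. 0)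
           (mittag_leffler A \<alpha> (real (k - 1)) w)"
proof -
  let ?E = "mittag_leffler A \<alpha>"
  let ?x = "?E (real (k - 1)) w"
  have chain_x: "(?E (real (k - 1) - real i) w has_vector_derivative
      ?E (real (k - 1) - real (Suc i)) w s) (at s within {0..})" if "i < k - 1" "s \<ge> 0" for i s
    using that assms by (intro mittag_leffler_chain) auto
  note x = nderiv_chain[where f = ?x and F = "\<lambda>i. ?E (real (k - 1) - real i) w" and n = "k - 1",
      OF _ chain_x, simplified]
  \<comment> \<open>The derivative of order \<open>j\<close> has index \<open>k - 1 - j\<close>, and
    a series of positive index vanishes at 0.\<close>
  have init: "nderiv j ?x 0 = (if j = k - 1 then w else 0)" if "j < k" for j
    using x(1)[of j 0] that assms by (auto simp: mittag_leffler_at_0 of_nat_diff)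
  have "continuous_on {0..} (nderiv (k - 1) ?x) \<longleftrightarrow> continuous_on {0..} (?E 0 w)"
    using x(1)[of "k - 1"] by (intro continuous_on_cong) auto
  then have smooth: "C_halfline (k - 1) ?x"
    using x(2) continuous_on_mittag_leffler[OF assms(1), of 0 A w]
    by (auto simp: C_halfline_def intro: differentiableI_vector)
  have remainder: "?x s - (\<Sum>j<k. (s ^ j / fact j) *\<^sub>R nderiv j ?x 0) = ?E (real (k - 1) + \<alpha>) (A *v w) s"
    if "s \<ge> 0" for s
  proof -
    have "(\<Sum>j<k. (s ^ j / fact j) *\<^sub>R nderiv j ?x 0)
        = (\<Sum>j<k. if j = k - 1 then (s ^ (k - 1) / fact (k - 1)) *\<^sub>R w else 0)"
      by (intro sum.cong refl) (subst init, auto)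
    also have "\<dots> = RL_kernel (real (k - 1)) s *\<^sub>R w"
      using assms(2) RL_kernel_of_nat[OF that, of "k - 1"] by simp
    finally show ?thesis
      using mittag_leffler_split[OF assms(1) _ that, of "real (k - 1)" A w] by simp
  qed
  \<comment> \<open>The summand \<open>- real 0\<close> gives the right-hand side the form
    \<open>F 0 s\<close> expected by \<open>nderiv_chain\<close>.\<close>
  have J: "caputo_remainder_integral \<alpha> k ?x s = ?E (2 * real k - 1 - real 0) (A *v w) s" if "s \<ge> 0" for s
  proof -
    have "caputo_remainder_integral \<alpha> k ?x s
        = RL_integral (real k - \<alpha>) (?E (real (k - 1) + \<alpha>) (A *v w)) s"
      unfolding caputo_remainder_integral_def using that remainder by (intro RL_integral_cong) auto
    also have "\<dots> = ?E (real (k - 1) + \<alpha> + (real k - \<alpha>)) (A *v w) s"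
      using assms that by (intro RL_integral_mittag_leffler) auto
    finally show ?thesis
      using assms by (simp add: of_nat_diff)
  qed
  have chain_J: "(?E (2 * real k - 1 - real i) (A *v w) has_vector_derivative
      ?E (2 * real k - 1 - real (Suc i)) (A *v w) s) (at s within {0..})" if "i < k" "s \<ge> 0" for i s
    using that assms by (intro mittag_leffler_chain) auto
  have y: "(nderiv i (caputo_remainder_integral \<alpha> k ?x) has_vector_derivative
      ?E (2 * real k - 1 - real (Suc i)) (A *v w) s) (at s within {0..})" if "i < k" "s \<ge> 0" for i s
    using nderiv_chain(2)[where F = "\<lambda>i. ?E (2 * real k - 1 - real i) (A *v w)", OF J chain_J that] .
  have "has_caputo_derivative \<alpha> k ?x (A *v ?x \<tau>) \<tau>" if "\<tau> > 0" for \<tau>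
    unfolding has_caputo_derivative_def
  proof (intro conjI allI impI)
    fix i assume "i < k - 1"
    then have "nderiv i (caputo_remainder_integral \<alpha> k ?x) differentiable (at s within {0..})"
      if "s > 0" for s
      using that by (intro differentiableI_vector[OF y]) auto
    \<comment> \<open>Differentiability is asked on a full neighbourhood of \<tau>; the open
      half-line is one.\<close>
    with eventually_nhds_in_open[of "{0<..}" \<tau>] \<open>\<tau> > 0\<close>
    show "\<forall>\<^sub>F s in nhds \<tau>. nderiv i (caputo_remainder_integral \<alpha> k ?x) differentiable (at s within {0..})"
      by (auto elim: eventually_mono)
  next
    have "(nderiv (k - 1) (caputo_remainder_integral \<alpha> k ?x) has_vector_derivative
        ?E (2 * real k - 1 - real (Suc (k - 1))) (A *v w) \<tau>) (at \<tau> within {0..})"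
      using y[of "k - 1" \<tau>] assms that by simp
    moreover have "2 * real k - 1 - real (Suc (k - 1)) = real (k - 1)"
      using assms by (simp add: of_nat_diff)
    ultimately show "(nderiv (k - 1) (caputo_remainder_integral \<alpha> k ?x) has_vector_derivative
        A *v ?x \<tau>) (at \<tau> within {0..})"
      using assms that by (simp add: mult_vec_mittag_leffler)
  qed
  with smooth init show ?thesis
    by (simp add: caputo_solution_def)
qed

section \<open>Unobservable directions of the standard system\<close>

text \<open>Differentiating \<open>C A^l d = 0\<close> along the equation adds one factor
  \<open>A\<close>. The equation is given only at positive times, so the value at 0 comes from a
  right limit.\<close>

lemma derivatives_vanish_at_0:
  fixes A :: "real^'n^'n" and C :: "real^'n^'z"
  assumes "\<epsilon> > 0" and cont: "continuous_on {0..} d"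
    and ode: "\<And>\<tau>. 0 < \<tau> \<Longrightarrow> \<tau> < \<epsilon> \<Longrightarrow> (d has_vector_derivative A *v d \<tau>) (at \<tau>)"
    and out: "\<And>\<tau>. 0 < \<tau> \<Longrightarrow> \<tau> < \<epsilon> \<Longrightarrow> C *v d \<tau> = 0"
  shows "C *v ((*v) A ^^ l) (d 0) = 0"
proof -
  have lin: "bounded_linear (\<lambda>x. C *v ((*v) A ^^ l) x)" for l
  proof -
    have "linear ((*v) A ^^ l)"
      by (induction l) (use linear_id in \<open>auto simp: id_def intro: linear_compose simp del: o_apply\<close>)
    then have "linear ((*v) C \<circ> ((*v) A ^^ l))"
      by (intro linear_compose) auto
    then show ?thesis
      by (simp add: linear_conv_bounded_linear o_def)
  qed
  have zero: "C *v ((*v) A ^^ l) (d \<tau>) = 0" if "0 < \<tau>" "\<tau> < \<epsilon>" for \<tau> l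
    using that
  proof (induction l arbitrary: \<tau>)
    case (Suc l)
    have "((\<lambda>s. C *v ((*v) A ^^ l) (d s)) has_vector_derivative C *v ((*v) A ^^ l) (A *v d \<tau>)) (at \<tau>)"
      using bounded_linear.has_vector_derivative[OF lin ode] Suc.prems by blast
    moreover have "((\<lambda>s. C *v ((*v) A ^^ l) (d s)) has_vector_derivative 0) (at \<tau>)"
      using Suc.prems Suc.IH
      by (intro has_vector_derivative_transform_within_open[OF has_vector_derivative_const,
            where S = "{0<..<\<epsilon>}"]) auto
    ultimately have "C *v ((*v) A ^^ l) (A *v d \<tau>) = 0"
      by (rule vector_derivative_unique_at)
    then show ?case
      by (simp add: funpow_mult_vec_shift)
  qed (simp add: out)
  have "continuous_on {0..} (\<lambda>s. C *v ((*v) A ^^ l) (d s))"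
    using bounded_linear.continuous_on[OF lin cont] .
  then have "((\<lambda>s. C *v ((*v) A ^^ l) (d s)) \<longlongrightarrow> C *v ((*v) A ^^ l) (d 0)) (at 0 within {0..})"
    by (auto simp: continuous_on_def)
  then have "((\<lambda>s. C *v ((*v) A ^^ l) (d s)) \<longlongrightarrow> C *v ((*v) A ^^ l) (d 0)) (at_right 0)"
    by (rule tendsto_within_subset) auto
  moreover have "\<forall>\<^sub>F s in at_right 0. C *v ((*v) A ^^ l) (d s) = 0"
    using eventually_at_right_less[of 0] eventually_at_right_real[OF \<open>\<epsilon> > 0\<close>]
    by eventually_elim (use zero in auto)
  then have "((\<lambda>s. C *v ((*v) A ^^ l) (d s)) \<longlongrightarrow> 0) (at_right 0)"
    by (rule tendsto_eventually)
  ultimately show ?thesis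
    by (intro tendsto_unique[of "at_right (0::real)"]) auto
qed

text \<open>The control cancels in the difference of the solutions wherever \<open>u\<close> is
  continuous, and admissibility leaves an interval to the right of 0 free of
  discontinuities.\<close>

lemma standard_indistinguishable_difference:
  fixes A :: "real^'n^'n" and B :: "real^'m^'n" and C :: "real^'n^'z"
  assumes "T > 0" "admissible_control u"
    and x: "standard_solution A B x0 u x" and x': "standard_solution A B x0' u x'"
    and out: "\<forall>\<tau>\<in>{0..T}. C *v x \<tau> = C *v x' \<tau>"
  shows "C *v ((*v) A ^^ l) (x0 - x0') = 0"
proof -
  \<comment> \<open>A discontinuity at 0 would make the minimum 0, so 0 is removed. Inserting
    \<open>T\<close> below keeps \<epsilon> within the interval where the outputs agree.\<close>
  define S where "S = {\<tau>\<in>{0..T}. \<not> continuous (at \<tau> within {0..}) u} - {0}"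
  define \<epsilon> where "\<epsilon> = Min (insert T S)"
  have S: "finite S"
    using assms(2) by (simp add: S_def admissible_control_def)
  then have "\<epsilon> > 0" "\<epsilon> \<le> T"
    using assms(1) by (auto simp: \<epsilon>_def S_def)
  have cont_u: "continuous (at \<tau>) u" if "0 < \<tau>" "\<tau> < \<epsilon>" for \<tau>
  proof -
    have "\<tau> \<notin> S"
      using that S by (auto simp: \<epsilon>_def)
    then have "continuous (at \<tau> within {0..}) u"
      using that \<open>\<epsilon> \<le> T\<close> by (auto simp: S_def)
    moreover have "at \<tau> within {0..} = at \<tau>"
      using that by (intro at_within_interior) (simp add: interior_real_atLeast)
    ultimately show ?thesis by simp
  qed
  have "C *v ((*v) A ^^ l) ((\<lambda>\<tau>. x \<tau> - x' \<tau>) 0) = 0"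
  proof (rule derivatives_vanish_at_0[OF \<open>\<epsilon> > 0\<close>])
    show "continuous_on {0..} (\<lambda>\<tau>. x \<tau> - x' \<tau>)"
      using x x' by (auto simp: standard_solution_def intro: continuous_on_diff)
  next
    fix \<tau> assume \<tau>: "0 < \<tau>" "\<tau> < \<epsilon>"
    have "((\<lambda>\<tau>. x \<tau> - x' \<tau>) has_vector_derivative
        (A *v x \<tau> + B *v u \<tau>) - (A *v x' \<tau> + B *v u \<tau>)) (at \<tau>)"
      using x x' \<tau> cont_u by (intro has_vector_derivative_diff) (auto simp: standard_solution_def)
    then show "((\<lambda>\<tau>. x \<tau> - x' \<tau>) has_vector_derivative A *v (x \<tau> - x' \<tau>)) (at \<tau>)"
      by (simp add: matrix_vector_mult_diff_distrib)
    show "C *v (x \<tau> - x' \<tau>) = 0"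
      using out \<tau> \<open>\<epsilon> \<le> T\<close> by (simp add: matrix_vector_mult_diff_distrib)
  qed
  with x x' show ?thesis
    by (simp add: standard_solution_def)
qed

section \<open>Transfer to the Caputo system\<close>

theorem theorem4p2:
  fixes A :: "real^'n^'n" and B :: "real^'m^'n" and C :: "real^'n^'z"
    and \<alpha> t :: real and k :: nat
  assumes "CARD('z) \<le> CARD('n)"
    and "k \<ge> 1" and "\<alpha> > 0" and "real k - 1 < \<alpha>" and "\<alpha> \<le> real k"
    and "t > 0"
    and "caputo_observable A B C \<alpha> k t"
  shows "standard_observable A B C"
  unfolding standard_observable_def
proof (intro allI impI)
  fix T u x0 x0' x x'
  assume "T > 0" "admissible_control u" "standard_solution A B x0 u x"
    "standard_solution A B x0' u x'" "\<forall>\<tau>\<in>{0..T}. C *v x \<tau> = C *v x' \<tau>"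
  note ker = standard_indistinguishable_difference[OF this]
  let ?sol = "\<lambda>w. mittag_leffler A \<alpha> (real (k - 1)) w"
  let ?init = "\<lambda>w j. if j = k - 1 then w else 0"
  have "admissible_control (\<lambda>_. 0 :: real^'m)"
    by (auto simp: admissible_control_def image_constant_conv)
  moreover have "caputo_solution A B \<alpha> k (?init w) (\<lambda>_. 0) (?sol w)" for w
    using assms by (intro caputo_solution_mittag_leffler) auto
  moreover have "((*v) A ^^ l) 0 = 0" for l
    by (induction l) auto
  \<comment> \<open>On the left \<open>ker\<close> kills every coefficient of the output series; on
    the right the series with \<open>w = 0\<close> is the zero solution.\<close>
  then have "\<forall>\<tau>\<in>{0..t}. C *v ?sol (x0 - x0') \<tau> = C *v ?sol 0 \<tau>"
    using assms ker by (simp add: mult_vec_mittag_leffler_series)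
  ultimately have "\<forall>j<k. ?init (x0 - x0') j = ?init 0 j"
    using assms(7) unfolding caputo_observable_def by blast
  from this[rule_format, of "k - 1"] assms(2) show "x0 = x0'"
    by simp
qed

end
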